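(* Let $G=(V,E)$ be a simple, connected, undirected graph with $m$ edges, fix a root $r\in V$, and for each $u\neq r$ fix a simple directed path $\mathcal{P}_u$ in $G$ from $u$ to $r$. For a spanning tree $\tau$ define $$f(\tau)=\sum_{u\neq r}d(u)\left(\sum_{T_1\cup T_2\in\mathbb{F}^{\mathcal{P}_u}(\tau)}\mathrm{vol}(T_1)-\sum_{T_1\cup T_2\in\mathbb{F}^{\mathcal{P}_u'}(\tau)}\mathrm{vol}(T_1)\right),$$ where $T_1$ denotes the node set of the tree of the 2-forest containing $r$. Let $\hat\tau_1,\dots,\hat\tau_\omega$ be spanning trees each drawn uniformly at random from the set $\Gamma$ of all spanning trees of $G$. Then $\tilde\kappa=\frac{1}{2m\omega}\sum_{i=1}^{\omega}f(\hat\tau_i)$ is an unbiased estimator of $\kappa(G)$, i.e. $\mathbb{E}[\tilde\kappa]=\kappa(G)$.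
   Context: $d(v)$ is the degree of $v$ in $G$ and $\mathrm{vol}(S)=\sum_{v\in S}d(v)$. $\kappa(G)$ is the Kemeny constant: $\kappa(G)=\sum_j\frac{d(j)}{2m}H(i,j)$ with $H(i,j)$ the expected hitting time from $i$ to $j$ of the simple random walk on $G$ (independent of $i$); equivalently the sum of reciprocals of the nonzero eigenvalues of $I-D^{-1/2}AD^{-1/2}$. A 2-forest is a spanning forest with exactly two trees. For a simple directed path $\mathcal{P}$ from $u$ to $r$ and spanning tree $\tau$ with $\mathcal{P}^{(\tau)}_{u\to r}$ the unique $u$-to-$r$ path in $\tau$ (edges directed towards $r$): $\mathbb{F}^{\mathcal{P}}(\tau)=\{\tau\setminus\{i,j\}: (i,j)\in\mathcal{P},\ (i,j)\in\mathcal{P}^{(\tau)}_{u\to r}\}$ and $\mathbb{F}^{\mathcal{P}'}(\tau)=\{\tau\setminus\{i,j\}: (i,j)\in\mathcal{P},\ (j,i)\in\mathcal{P}^{(\tau)}_{u\to r}\}$, where membership of $(i,j)$ refers to directed edges along the path. *)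

theory Defs
  imports "HOL-Probability.Probability"
begin

section \<open>Graphs\<close>

definition simple_graph :: "'a set \<Rightarrow> 'a set set \<Rightarrow> bool" where
  "simple_graph V E \<longleftrightarrow> finite V \<and> V \<noteq> {} \<and> (\<forall>e\<in>E. e \<subseteq> V \<and> card e = 2)"

definition adj :: "'a set set \<Rightarrow> ('a \<times> 'a) set" where
  "adj F = {(x, y). {x, y} \<in> F}"

definition neighbours :: "'a set set \<Rightarrow> 'a \<Rightarrow> 'a set" where
  "neighbours E v = {w. {v, w} \<in> E}"

definition vertex_degree :: "'a set set \<Rightarrow> 'a \<Rightarrow> nat" where
  "vertex_degree E v = card (neighbours E v)"

definition vol :: "'a set set \<Rightarrow> 'a set \<Rightarrow> nat" where
  "vol E S = (\<Sum>v\<in>S. vertex_degree E v)"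

definition connected_graph :: "'a set \<Rightarrow> 'a set set \<Rightarrow> bool" where
  "connected_graph V F \<longleftrightarrow> (\<forall>u\<in>V. \<forall>v\<in>V. (u, v) \<in> (adj F)\<^sup>*)"

definition component :: "'a set set \<Rightarrow> 'a \<Rightarrow> 'a set" where
  "component F v = (adj F)\<^sup>* `` {v}"

definition arcs :: "'a list \<Rightarrow> ('a \<times> 'a) set" where
  "arcs p = set (zip p (tl p))"

definition is_simple_path :: "'a set set \<Rightarrow> 'a \<Rightarrow> 'a list \<Rightarrow> 'a \<Rightarrow> bool" where
  "is_simple_path F u p v \<longleftrightarrow>
     p \<noteq> [] \<and> hd p = u \<and> last p = v \<and> distinct p \<and> arcs p \<subseteq> adj F"

definition is_cycle :: "'a set set \<Rightarrow> 'a list \<Rightarrow> bool" where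
  "is_cycle F p \<longleftrightarrow> 3 \<le> length p \<and> distinct p \<and> arcs p \<subseteq> adj F \<and> (last p, hd p) \<in> adj F"

definition spanning_trees :: "'a set \<Rightarrow> 'a set set \<Rightarrow> 'a set set set" where
  "spanning_trees V E = {\<tau>. \<tau> \<subseteq> E \<and> connected_graph V \<tau> \<and> (\<nexists>p. is_cycle \<tau> p)}"

definition tree_path :: "'a set set \<Rightarrow> 'a \<Rightarrow> 'a \<Rightarrow> 'a list" where
  "tree_path \<tau> u r = (THE p. is_simple_path \<tau> u p r)"


section \<open>The simple random walk and the Kemeny constant\<close>

text \<open>
  The walk is driven by an i.i.d. sequence of random maps, each of which chooses, for all vertices
  independently, a uniformly distributed neighbour (a uniform element of a product of finite sets);
  the walk at \<open>v\<close> at time \<open>n\<close> moves to the value of the \<open>n\<close>-th map at \<open>v\<close>. Only one value of each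
  map is ever used, so this is the simple random walk; see \<open>walk_law\<close> below.
\<close>

definition walk_space :: "'a set \<Rightarrow> 'a set set \<Rightarrow> ('a \<Rightarrow> 'a) stream measure" where
  "walk_space V E = stream_space (uniform_count_measure (\<Pi>\<^sub>E v\<in>V. neighbours E v))"

primrec walk :: "'a \<Rightarrow> ('a \<Rightarrow> 'a) stream \<Rightarrow> nat \<Rightarrow> 'a" where
  "walk i s 0 = i"
| "walk i s (Suc n) = (s !! n) (walk i s n)"

text \<open>The infimum is \<open>\<infinity>\<close> if \<open>j\<close> is never hit, and \<open>0\<close> if the walk starts in \<open>j\<close>.\<close>

definition hitting_time :: "'a \<Rightarrow> 'a \<Rightarrow> ('a \<Rightarrow> 'a) stream \<Rightarrow> ennreal" where
  "hitting_time i j s = (INF n\<in>{n. walk i s n = j}. of_nat n)"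

definition expected_hitting_time :: "'a set \<Rightarrow> 'a set set \<Rightarrow> 'a \<Rightarrow> 'a \<Rightarrow> ennreal" where
  "expected_hitting_time V E i j = (\<integral>\<^sup>+ s. hitting_time i j s \<partial>walk_space V E)"

text \<open>
  The common value, over all starting vertices \<open>i\<close>, of \<open>\<Sum>\<^sub>j d(j)/(2m) H(i,j)\<close>. On a connected
  graph all \<open>H(i,j)\<close> are finite, so the conversion to \<open>real\<close> loses nothing.
\<close>

definition kemeny :: "'a set \<Rightarrow> 'a set set \<Rightarrow> real" where
  "kemeny V E = (THE k. \<forall>i\<in>V.
     k = (\<Sum>j\<in>V. real (vertex_degree E j) / (2 * real (card E)) * enn2real (expected_hitting_time V E i j)))"

lemma walk_SCons: "walk i (f ## s) (Suc n) = walk (f i) s n"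
  by (induction n) auto

lemma neighbours_finite_subset: assumes G: "simple_graph V E" shows "finite (neighbours E v)" "neighbours E v \<subseteq> V"
proof -
  show *: "neighbours E v \<subseteq> V" using G by (auto simp: neighbours_def simple_graph_def)
  show "finite (neighbours E v)" using * G finite_subset by (auto simp: simple_graph_def)
qed

lemma walk_law:
  fixes V :: "'a set"
  assumes G: "simple_graph V E" and no_isolated: "\<And>v. v \<in> V \<Longrightarrow> neighbours E v \<noteq> {}"
  assumes "x 0 \<in> V" and "\<And>k. k < n \<Longrightarrow> {x k, x (Suc k)} \<in> E"
  shows "emeasure (walk_space V E) {s \<in> space (walk_space V E). \<forall>k\<le>n. walk (x 0) s k = x k}
           = (\<Prod>k<n. ennreal (1 / real (vertex_degree E (x k))))"
  using assms(3,4)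
proof -
  let ?N = "neighbours E"
  let ?A = "\<Pi>\<^sub>E v\<in>V. ?N v"
  let ?U = "uniform_count_measure ?A"
  note fin = neighbours_finite_subset[OF G]
  have fV: "finite V" using G by (simp add: simple_graph_def)
  have finA: "finite ?A" using fin fV by (intro finite_PiE) auto
  have neA: "?A \<noteq> {}" using no_isolated by (simp add: PiE_eq_empty_iff)
  interpret U: prob_space ?U using prob_space_uniform_count_measure[OF finA neA] .
  have xV: "x k \<in> V" if "k \<le> n" for k
    using that assms(3) assms(4)[of "k - 1"] G by (cases k) (force simp: simple_graph_def)+
  have sets: "{s \<in> space (stream_space ?U). \<forall>k<m. (s !! k) (y k) = y (Suc k)} \<in> sets (stream_space ?U)" for m and y :: "nat \<Rightarrow> 'a"
  proof -
    have "{f \<in> space ?U. f (y k) = y (Suc k)} \<in> sets ?U" for k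
      by (auto simp: sets_uniform_count_measure space_uniform_count_measure)
    then have [measurable]: "Measurable.pred ?U (\<lambda>f. f (y k) = y (Suc k))" for k
      by (simp add: pred_def)
    show ?thesis by measurable
  qed
  have eq: "(\<forall>k\<le>m. walk (y 0) s k = y k) \<longleftrightarrow> (\<forall>k<m. (s !! k) (y k) = y (Suc k))" for m s and y :: "nat \<Rightarrow> 'a"
  proof
    assume L: "\<forall>k\<le>m. walk (y 0) s k = y k"
    show "\<forall>k<m. (s !! k) (y k) = y (Suc k)"
    proof (intro allI impI)
      fix k assume "k < m"
      then have "walk (y 0) s k = y k" "walk (y 0) s (Suc k) = y (Suc k)" using L by (blast intro: less_imp_le Suc_leI)+
      then show "(s !! k) (y k) = y (Suc k)" by simp
    qed
  next
    assume R: "\<forall>k<m. (s !! k) (y k) = y (Suc k)"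
    show "\<forall>k\<le>m. walk (y 0) s k = y k"
    proof (intro allI impI)
      fix k assume "k \<le> m" then show "walk (y 0) s k = y k" using R by (induction k) auto
    qed
  qed
  have one: "emeasure ?U {f \<in> space ?U. f v = w} = ennreal (1 / real (vertex_degree E v))"
    if v: "v \<in> V" and w: "{v, w} \<in> E" for v w
  proof -
    have "{f \<in> ?A. f v = w} = (\<Pi>\<^sub>E u\<in>V. (?N(v := {w})) u)"
      using v w by (auto simp: PiE_iff neighbours_def extensional_def split: if_splits)
    then have "card {f \<in> ?A. f v = w} = (\<Prod>u\<in>V. card ((?N(v := {w})) u))"
      using fV by (simp add: card_PiE)
    also have "\<dots> = (\<Prod>u\<in>V - {v}. card (?N u))"
      using fV v by (subst prod.remove[OF fV v]) (auto intro!: prod.cong)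
    finally have c: "card {f \<in> ?A. f v = w} = (\<Prod>u\<in>V - {v}. card (?N u))" .
    have "card ?A = card (?N v) * (\<Prod>u\<in>V - {v}. card (?N u))"
      using fV v by (simp add: card_PiE prod.remove)
    moreover have "(\<Prod>u\<in>V - {v}. card (?N u)) \<noteq> 0"
      using fV fin no_isolated by auto
    ultimately have "real (card {f \<in> ?A. f v = w}) / real (card ?A) = 1 / real (vertex_degree E v)"
      using c by (simp add: vertex_degree_def del: of_nat_prod)
    then show ?thesis
      using finA by (subst emeasure_uniform_count_measure) (auto simp: space_uniform_count_measure)
  qed
  have main: "emeasure (stream_space ?U) {s \<in> space (stream_space ?U). \<forall>k<m. (s !! k) (y k) = y (Suc k)}
      = (\<Prod>k<m. ennreal (1 / real (vertex_degree E (y k))))"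
    if "\<And>k. k \<le> m \<Longrightarrow> y k \<in> V" "\<And>k. k < m \<Longrightarrow> {y k, y (Suc k)} \<in> E" for m and y :: "nat \<Rightarrow> 'a"
    using that
  proof (induction m arbitrary: y)
    case 0
    interpret S: prob_space "stream_space ?U" by (rule U.prob_space_stream_space)
    show ?case using S.emeasure_space_1 by simp
  next
    case (Suc m)
    let ?B = "{s \<in> space (stream_space ?U). \<forall>k<m. (s !! k) (y (Suc k)) = y (Suc (Suc k))}"
    let ?c = "\<Prod>k<m. ennreal (1 / real (vertex_degree E (y (Suc k))))"
    have IH: "emeasure (stream_space ?U) ?B = ?c"
      using Suc.IH[of "\<lambda>k. y (Suc k)"] Suc.prems by simp
    have "emeasure (stream_space ?U) {s \<in> space (stream_space ?U). \<forall>k<Suc m. (s !! k) (y k) = y (Suc k)}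
      = (\<integral>\<^sup>+f. emeasure (stream_space ?U) {s \<in> space (stream_space ?U). f ## s \<in> {s \<in> space (stream_space ?U). \<forall>k<Suc m. (s !! k) (y k) = y (Suc k)}} \<partial>?U)"
      by (rule U.emeasure_stream_space) (rule sets)
    also have "\<dots> = (\<integral>\<^sup>+f. ?c * indicator {f \<in> space ?U. f (y 0) = y 1} f \<partial>?U)"
    proof (rule nn_integral_cong)
      fix f assume f: "f \<in> space ?U"
      have "{s \<in> space (stream_space ?U). f ## s \<in> {s \<in> space (stream_space ?U). \<forall>k<Suc m. (s !! k) (y k) = y (Suc k)}}
        = (if f (y 0) = y 1 then ?B else {})"
        using f by (auto simp: space_stream_space streams_Stream All_less_Suc2)
      then show "emeasure (stream_space ?U) {s \<in> space (stream_space ?U). f ## s \<in> {s \<in> space (stream_space ?U). \<forall>k<Suc m. (s !! k) (y k) = y (Suc k)}} = ?c * indicator {f \<in> space ?U. f (y 0) = y 1} f"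
        using IH f by simp
    qed
    also have "\<dots> = ?c * emeasure ?U {f \<in> space ?U. f (y 0) = y 1}"
      by (rule nn_integral_cmult_indicator) (auto simp: sets_uniform_count_measure space_uniform_count_measure)
    also have "\<dots> = ?c * ennreal (1 / real (vertex_degree E (y 0)))"
      using one[of "y 0" "y 1"] Suc.prems(1)[of 0] Suc.prems(2)[of 0] by simp
    finally show ?case by (simp add: prod.lessThan_Suc_shift mult.commute del: prod.lessThan_Suc)
  qed
  show ?thesis
    unfolding walk_space_def eq using main[of n x] xV assms(4) by blast
qed


section \<open>The estimator\<close>

text \<open>
  Spanning forests are represented by their edge sets. \<open>P\<close> is a path from \<open>u\<close> to \<open>r\<close>, listed from
  \<open>u\<close>; an edge of the forward (backward) set is traversed by \<open>P\<close> and by the tree path from \<open>u\<close> to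
  \<open>r\<close> in the same (opposite) direction.
\<close>

definition forests_fwd :: "'a list \<Rightarrow> 'a \<Rightarrow> 'a \<Rightarrow> 'a set set \<Rightarrow> 'a set set set" where
  "forests_fwd P u r \<tau> = {\<tau> - {{i, j}} | i j. (i, j) \<in> arcs P \<and> (i, j) \<in> arcs (tree_path \<tau> u r)}"

definition forests_bwd :: "'a list \<Rightarrow> 'a \<Rightarrow> 'a \<Rightarrow> 'a set set \<Rightarrow> 'a set set set" where
  "forests_bwd P u r \<tau> = {\<tau> - {{i, j}} | i j. (i, j) \<in> arcs P \<and> (j, i) \<in> arcs (tree_path \<tau> u r)}"

definition tree_stat ::
  "'a set \<Rightarrow> 'a set set \<Rightarrow> 'a \<Rightarrow> ('a \<Rightarrow> 'a list) \<Rightarrow> 'a set set \<Rightarrow> real" where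
  "tree_stat V E r P \<tau> = (\<Sum>u\<in>V - {r}. real (vertex_degree E u) *
     ((\<Sum>F\<in>forests_fwd (P u) u r \<tau>. real (vol E (component F r)))
      - (\<Sum>F\<in>forests_bwd (P u) u r \<tau>. real (vol E (component F r)))))"

definition kemeny_estimator ::
  "'a set \<Rightarrow> 'a set set \<Rightarrow> 'a \<Rightarrow> ('a \<Rightarrow> 'a list) \<Rightarrow> nat \<Rightarrow> (nat \<Rightarrow> 'a set set) \<Rightarrow> real" where
  "kemeny_estimator V E r P \<omega> \<tau> =
     1 / (2 * real (card E) * real \<omega>) * (\<Sum>i=1..\<omega>. tree_stat V E r P (\<tau> i))"

end

theory Submission
  imports Defs
begin

text \<open>
  For vertices \<open>x \<noteq> u\<close>, \<open>|\<Gamma>| H(x,u)\<close> equals the sum of \<open>vol(F\<^sub>x)\<close> over the 2-forests \<open>F\<close>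
  separating \<open>x\<close> from \<open>u\<close>, where \<open>F\<^sub>x\<close> is the tree of \<open>x\<close>: deleting a fixed edge \<open>xy\<close> is a
  bijection from the trees containing \<open>xy\<close> to the 2-forests separating \<open>x\<close> from \<open>y\<close>, and with it
  one checks, tree by tree, that this sum satisfies the Dirichlet problem of the hitting times.
  The Kemeny constant is then a sum of \<open>vol(T\<^sub>1) vol(T\<^sub>2)\<close> over all 2-forests, whatever the starting
  vertex. Summing the statistic over all trees, the same bijection regroups the terms by 2-forest
  \<open>F\<close>: \<open>F\<close> contributes only if it separates \<open>u\<close> from \<open>r\<close>, and then with net weight one, since the path
  from \<open>u\<close> to \<open>r\<close> leaves the tree of \<open>u\<close> once more than it enters it.
\<close>

section \<open>Reachability and simple paths\<close>

abbreviation linked :: "'a set set \<Rightarrow> 'a \<Rightarrow> 'a \<Rightarrow> bool" where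
  "linked F x y \<equiv> (x, y) \<in> (adj F)\<^sup>*"

lemma linked_sym: "linked F x y \<Longrightarrow> linked F y x"
  by (rule symD[OF sym_rtrancl]) (auto simp: sym_def adj_def insert_commute)

lemma linked_trans: "linked F x y \<Longrightarrow> linked F y z \<Longrightarrow> linked F x z"
  by (rule rtrancl_trans)

lemma linked_common: "linked F z x \<Longrightarrow> linked F z y \<Longrightarrow> linked F x y"
  by (blast intro: linked_trans linked_sym)

lemma linked_mono: "linked F x y \<Longrightarrow> F \<subseteq> F' \<Longrightarrow> linked F' x y"
  by (rule subsetD[OF rtrancl_mono]) (auto simp: adj_def)

lemma linked_edge: "{x, y} \<in> F \<Longrightarrow> linked F x y"
  by (auto simp: adj_def)

text \<open>One crossing of the new edge is enough to record: a second one either returns to the end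
  from which the first one left, already reached inside \<open>F\<close>, or repeats the first one,
  and then \<open>F\<close> itself links \<open>x\<close> and \<open>y\<close>.\<close>

lemma linked_insertD:
  assumes "linked (insert {x, y} F) a b"
  shows "linked F a b \<or> linked F a x \<and> linked F y b \<or> linked F a y \<and> linked F x b"
  using assms
proof (induction rule: rtrancl_induct)
  case (step b c)
  from step.hyps(2) consider "{b, c} \<in> F" | "b = x" "c = y" | "b = y" "c = x"
    by (auto simp: adj_def doubleton_eq_iff)
  then show ?case
  proof cases
    case 1
    then show ?thesis using step.IH linked_trans[OF _ linked_edge[OF 1]] by blast
  next
    case 2
    then show ?thesis using step.IH linked_sym[of x y F] linked_trans[of a _ F _] by auto
  next
    case 3
    then show ?thesis using step.IH linked_trans[of a _ F _] by auto
  qed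
qed simp

lemma arcs_simps [simp]: "arcs [] = {}" "arcs [x] = {}"
    "arcs (x # y # p) = insert (x, y) (arcs (y # p))"
  by (auto simp: arcs_def)

lemma finite_arcs [simp]: "finite (arcs p)"
  by (simp add: arcs_def)

lemma arcsD: "(x, y) \<in> arcs p \<Longrightarrow> x \<in> set p \<and> y \<in> set p"
  by (induction p rule: induct_list012) auto

lemma arcs_append: "arcs (p @ x # q) = arcs (p @ [x]) \<union> arcs (x # q)"
proof (induction p)
  case (Cons a p)
  show ?case by (cases p; use Cons in auto)
qed simp

lemma arcs_split: "(x, y) \<in> arcs p \<Longrightarrow> \<exists>p1 p2. p = p1 @ x # y # p2"
proof (induction p rule: induct_list012)
  case (3 a b p)
  then consider "a = x" "b = y" | "(x, y) \<in> arcs (b # p)" by auto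
  then show ?case
  proof cases
    case 1
    then have "a # b # p = [] @ x # y # p" by simp
    then show ?thesis by blast
  next
    case 2
    then show ?thesis using 3 by (metis append_Cons)
  qed
qed auto

lemma linked_hd_last:
  assumes "p \<noteq> []" "arcs p \<subseteq> adj F"
  shows "linked F (hd p) (last p)"
  using assms
proof (induction p)
  case (Cons a p)
  then show ?case by (cases p) (auto intro: converse_rtrancl_into_rtrancl)
qed simp

text \<open>Induction along the walk; when it returns to a vertex already on the path, the path is
  cut back to that vertex.\<close>

lemma linked_imp_simple_path:
  assumes "linked F u v"
  obtains p where "is_simple_path F u p v"
  using assms
proof (induction arbitrary: thesis rule: rtrancl_induct)
  case base
  show ?case by (rule base[of "[u]"]) (simp add: is_simple_path_def)
next
  case (step v w)
  obtain p where p: "is_simple_path F u p v" by (rule step.IH)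
  show ?case
  proof (cases "w \<in> set p")
    case True
    then obtain p1 p2 where s: "p = p1 @ w # p2" by (meson split_list)
    have "is_simple_path F u (p1 @ [w]) w"
      using p arcs_append[of p1 w p2] s by (cases p1) (auto simp: is_simple_path_def)
    then show ?thesis by (rule step.prems)
  next
    case False
    obtain q where q: "p = q @ [v]"
      using p by (metis append_butlast_last_id is_simple_path_def)
    have "is_simple_path F u (q @ [v, w]) w"
      using p False step.hyps(2) arcs_append[of q v "[w]"] q
      by (cases q) (auto simp: is_simple_path_def)
    then show ?thesis by (rule step.prems)
  qed
qed

text \<open>The first vertex of a distinct list has a single outgoing arc, so the arc set determines
  the next vertex. This reduces the uniqueness of tree paths to a description of their arcs.\<close>

lemma simple_path_eqI:
  assumes "distinct p" "distinct q" "p \<noteq> []" "q \<noteq> []" "hd p = hd q" "arcs p = arcs q"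
  shows "p = q"
  using assms
proof (induction p arbitrary: q)
  case (Cons x p)
  obtain q' where q: "q = x # q'" using Cons.prems by (cases q) auto
  show ?case
  proof (cases p)
    case Nil
    then show ?thesis using Cons.prems q by (cases q') auto
  next
    case (Cons y p')
    obtain z q'' where q': "q' = z # q''"
      using \<open>arcs (x # p) = arcs q\<close> q Cons by (cases q') auto
    have nx: "(x, a) \<notin> arcs p" "(x, a) \<notin> arcs q'" for a
      using arcsD[of x a p] arcsD[of x a q'] Cons.prems q by auto
    have eq: "insert (x, y) (arcs p) = insert (x, z) (arcs q')"
      using \<open>arcs (x # p) = arcs q\<close> q q' Cons by simp
    then have "y = z" using nx by blast
    moreover have "arcs p = arcs q'" using eq nx insert_ident[of "(x, y)"] \<open>y = z\<close> by simp
    ultimately have "p = q'"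
      using Cons.IH[of q'] Cons.prems q q' Cons by simp
    then show ?thesis using q by simp
  qed
qed simp

text \<open>\<open>arcs p\<close> is a set; since \<open>p\<close> is distinct, no arc occurs twice,
  and the sum over the set is the telescoping sum along the list.\<close>

lemma sum_arcs_telescope:
  fixes f :: "'a \<Rightarrow> 'b :: ab_group_add"
  assumes "distinct p" "p \<noteq> []"
  shows "(\<Sum>(x, y)\<in>arcs p. f x - f y) = f (hd p) - f (last p)"
  using assms
proof (induction p)
  case (Cons x p)
  show ?case
  proof (cases p)
    case (Cons y q)
    have "(x, y) \<notin> arcs p" using arcsD[of x y p] Cons.prems by auto
    then show ?thesis using Cons.IH Cons.prems Cons by simp
  qed simp
qed simp

lemma path_linked_avoiding:
  assumes "arcs p \<subseteq> adj F" "p \<noteq> []" "x \<notin> set p \<or> y \<notin> set p"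
  shows "linked (F - {{x, y}}) (hd p) (last p)"
proof (rule linked_hd_last)
  show "arcs p \<subseteq> adj (F - {{x, y}})"
  proof safe
    fix a b assume ab: "(a, b) \<in> arcs p"
    then have "a \<in> set p" "b \<in> set p" by (auto dest: arcsD)
    then have "{a, b} \<noteq> {x, y}" using assms(3) by (auto simp: doubleton_eq_iff)
    then show "(a, b) \<in> adj (F - {{x, y}})" using ab assms(1) by (auto simp: adj_def)
  qed
qed fact

section \<open>Cycles and bridges\<close>

text \<open>Replaces cycles by linkedness after the deletion of one edge. A simple path around a
  deleted edge closes up with it to a cycle, and a cycle leads around each of its edges.\<close>

lemma acyclic_iff_bridges:
  assumes "\<And>e. e \<in> F \<Longrightarrow> card e = 2"
  shows "(\<nexists>p. is_cycle F p) \<longleftrightarrow> (\<forall>x y. {x, y} \<in> F \<longrightarrow> \<not> linked (F - {{x, y}}) x y)"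
proof safe
  fix x y assume nc: "\<nexists>p. is_cycle F p" and e: "{x, y} \<in> F" and l: "linked (F - {{x, y}}) x y"
  have "x \<noteq> y" using assms[OF e] by auto
  obtain p where p: "is_simple_path (F - {{x, y}}) x p y" using l by (rule linked_imp_simple_path)
  then obtain q where q: "p = x # q" by (cases p) (auto simp: is_simple_path_def)
  with p \<open>x \<noteq> y\<close> obtain z q' where q': "q = z # q'" by (cases q) (auto simp: is_simple_path_def)
  \<comment> \<open>The path avoids \<open>{x, y}\<close>, so it has an inner vertex and thus the
    three vertices that \<open>is_cycle\<close> demands.\<close>
  with p q have "q' \<noteq> []" by (auto simp: is_simple_path_def adj_def)
  then have "is_cycle F p"
    using p q q' e by (cases q') (auto simp: is_cycle_def is_simple_path_def adj_def insert_commute)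
  then show False using nc by blast
next
  fix p assume br: "\<forall>x y. {x, y} \<in> F \<longrightarrow> \<not> linked (F - {{x, y}}) x y" and c: "is_cycle F p"
  then obtain x y z q where p: "p = x # y # z # q"
    by (auto simp: is_cycle_def Suc_le_length_iff numeral_3_eq_3)
  have "linked (F - {{x, y}}) (hd (y # z # q)) (last (y # z # q))"
    using c p by (intro path_linked_avoiding) (auto simp: is_cycle_def)
  moreover have "linked (F - {{x, y}}) (last p) x"
  proof (rule linked_edge)
    have "last p \<noteq> x" "last p \<noteq> y" using c p by (auto simp: is_cycle_def)
    then show "{last p, x} \<in> F - {{x, y}}"
      using c p by (auto simp: is_cycle_def adj_def doubleton_eq_iff)
  qed
  ultimately have "linked (F - {{x, y}}) y x"
    using p linked_trans[of y "last p" _ x] by simp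
  then have "linked (F - {{x, y}}) x y" by (rule linked_sym)
  moreover have "{x, y} \<in> F" using c p by (auto simp: is_cycle_def adj_def)
  ultimately show False using br by blast
qed

section \<open>Spanning trees and 2-forests\<close>

locale fin_connected_graph =
  fixes V :: "'a set" and E :: "'a set set"
  assumes simple: "simple_graph V E" and connected: "connected_graph V E"
begin

abbreviation \<Gamma> :: "'a set set set" where "\<Gamma> \<equiv> spanning_trees V E"

text \<open>The 2-forests: deleting an edge of a spanning tree leaves two trees, and in a connected
  graph every spanning forest with two trees arises so. In this form their properties follow from
  those of spanning trees.\<close>

definition \<Phi> :: "'a set set set" where "\<Phi> = {\<tau> - {e} | \<tau> e. \<tau> \<in> \<Gamma> \<and> e \<in> \<tau>}"

abbreviation deg :: "'a \<Rightarrow> real" where "deg v \<equiv> real (vertex_degree E v)"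

lemma finite_V: "finite V"
  using simple by (simp add: simple_graph_def)

lemma finite_E: "finite E"
proof (rule finite_subset)
  show "E \<subseteq> Pow V" using simple by (auto simp: simple_graph_def)
qed (simp add: finite_V)

lemma edgeD: "{x, y} \<in> E \<Longrightarrow> x \<in> V \<and> y \<in> V \<and> x \<noteq> y"
  using simple by (auto simp: simple_graph_def dest!: bspec)

lemma finite_\<Gamma>: "finite \<Gamma>"
  by (rule finite_subset[of _ "Pow E"]) (auto simp: spanning_trees_def finite_E)

lemma finite_\<Phi>: "finite \<Phi>"
  by (rule finite_subset[of _ "Pow E"]) (auto simp: \<Phi>_def spanning_trees_def finite_E)

lemma spanning_tree_iff:
  "\<tau> \<in> \<Gamma> \<longleftrightarrow> \<tau> \<subseteq> E \<and> connected_graph V \<tau> \<and>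
    (\<forall>x y. {x, y} \<in> \<tau> \<longrightarrow> \<not> linked (\<tau> - {{x, y}}) x y)"
proof -
  have "(\<nexists>p. is_cycle \<tau> p) \<longleftrightarrow> (\<forall>x y. {x, y} \<in> \<tau> \<longrightarrow> \<not> linked (\<tau> - {{x, y}}) x y)" if "\<tau> \<subseteq> E"
    using that simple by (intro acyclic_iff_bridges) (auto simp: simple_graph_def)
  then show ?thesis by (auto simp: spanning_trees_def)
qed

lemma bridge: "\<tau> \<in> \<Gamma> \<Longrightarrow> {x, y} \<in> \<tau> \<Longrightarrow> \<not> linked (\<tau> - {{x, y}}) x y"
  by (auto simp: spanning_tree_iff)

text \<open>Every vertex is linked in the tree to an end of the deleted edge, hence by
  \<open>linked_insertD\<close> linked in \<open>F\<close> to one of its two ends. So there are at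
  most two classes, and \<open>x\<close> and \<open>y\<close> represent both.\<close>

lemma forest_two_trees:
  assumes F: "F \<in> \<Phi>" and V: "x \<in> V" "y \<in> V" "z \<in> V" and n: "\<not> linked F x y"
  shows "linked F y z \<longleftrightarrow> \<not> linked F x z"
proof -
  obtain \<tau> e where t: "\<tau> \<in> \<Gamma>" "e \<in> \<tau>" "F = \<tau> - {e}" using F by (auto simp: \<Phi>_def)
  then have "card e = 2" using simple by (auto simp: simple_graph_def spanning_tree_iff)
  then obtain a b where e: "e = {a, b}" by (meson card_2_iff)
  then have "a \<in> V" using edgeD[of a b] t by (auto simp: spanning_tree_iff)
  have ins: "\<tau> = insert {a, b} F" using t e by auto
  have D: "linked F a w \<or> linked F b w" if "w \<in> V" for w
  proof -
    have "linked \<tau> a w" using t that \<open>a \<in> V\<close> by (auto simp: spanning_tree_iff connected_graph_def)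
    then show ?thesis using linked_insertD[of a w a b F] ins by auto
  qed
  have "linked F y z \<or> linked F x z"
    using D[OF V(1)] D[OF V(2)] D[OF V(3)] n linked_common[of a x F] linked_common[of b x F]
      linked_common[of _ y F z] by auto
  moreover have "\<not> linked F y z" if "linked F x z"
    using n linked_trans[OF that] linked_sym[of y z F] by blast
  ultimately show ?thesis by blast
qed

text \<open>Exchange property: any edge of the graph between the two trees restores a spanning tree,
  not only the edge whose deletion produced \<open>F\<close>. Hence the deletion of a fixed edge has
  an inverse on all 2-forests that separate its ends.\<close>

lemma spanning_tree_of_forest:
  assumes F: "F \<in> \<Phi>" and e: "{x, y} \<in> E" and n: "\<not> linked F x y"
  shows "insert {x, y} F \<in> \<Gamma>"
  unfolding spanning_tree_iff
proof (intro conjI allI impI)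
  obtain \<tau> d where t: "\<tau> \<in> \<Gamma>" "d \<in> \<tau>" "F = \<tau> - {d}" using F by (auto simp: \<Phi>_def)
  show "insert {x, y} F \<subseteq> E" using t e by (auto simp: spanning_tree_iff)
  show "connected_graph V (insert {x, y} F)"
    unfolding connected_graph_def
  proof safe
    fix u v assume V: "u \<in> V" "v \<in> V"
    let ?l = "linked (insert {x, y} F)"
    have "linked F x w \<or> linked F y w" if "w \<in> V" for w
      using forest_two_trees[OF F _ _ that n] edgeD[OF e] by blast
    then have "?l x w \<or> ?l y w" if "w \<in> V" for w
      using that linked_mono[of _ w F "insert {x, y} F"] by blast
    moreover have "?l x y" by (rule linked_edge) simp
    ultimately have "?l x w" if "w \<in> V" for w
      using that linked_trans[of x y _ w] by blast
    then show "?l u v" using V linked_common[of x u _ v] by blast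
  qed
  fix p q assume pq: "{p, q} \<in> insert {x, y} F"
  have nF: "{x, y} \<notin> F" using n linked_edge by metis
  show "\<not> linked (insert {x, y} F - {{p, q}}) p q"
  proof (cases "{p, q} = {x, y}")
    case True
    then have "insert {x, y} F - {{p, q}} = F" using nF by auto
    moreover have "\<not> linked F p q" using True n linked_sym by (metis doubleton_eq_iff)
    ultimately show ?thesis by simp
  next
    case False
    then have pF: "{p, q} \<in> F" using pq by auto
    have eq: "insert {x, y} F - {{p, q}} = insert {x, y} (F - {{p, q}})" using False by auto
    have "\<not> linked (\<tau> - {{p, q}}) p q" using t pF by (intro bridge) auto
    then have "\<not> linked (F - {{p, q}}) p q"
      using linked_mono[of p q "F - {{p, q}}" "\<tau> - {{p, q}}"] t by blast
    moreover have mono: "linked F a b" if "linked (F - {{p, q}}) a b" for a b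
      using that by (rule linked_mono) auto
    \<comment> \<open>A detour between \<open>p\<close> and \<open>q\<close> through the new edge,
      closed up by the edge \<open>{p, q}\<close> of \<open>F\<close>, would link \<open>x\<close>
      to \<open>y\<close> inside \<open>F\<close>.\<close>
    moreover have "\<not> (linked F p x \<and> linked F y q)" "\<not> (linked F p y \<and> linked F x q)"
      using linked_edge[OF pF] n linked_common[of p x F y] linked_common[of p y F x]
        linked_trans[of p q F] linked_sym[of _ q F] linked_sym[of y x F] by blast+
    ultimately show ?thesis
      unfolding eq using linked_insertD[of p q x y "F - {{p, q}}"] by blast
  qed
qed

lemma bij_remove_edge:
  assumes "{x, y} \<in> E"
  shows "bij_betw (\<lambda>\<tau>. \<tau> - {{x, y}}) {\<tau> \<in> \<Gamma>. {x, y} \<in> \<tau>} {F \<in> \<Phi>. \<not> linked F x y}"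
proof (rule bij_betw_byWitness[where f' = "insert {x, y}"])
  show "\<forall>\<tau>\<in>{\<tau> \<in> \<Gamma>. {x, y} \<in> \<tau>}. insert {x, y} (\<tau> - {{x, y}}) = \<tau>" by auto
  show "\<forall>F\<in>{F \<in> \<Phi>. \<not> linked F x y}. insert {x, y} F - {{x, y}} = F"
    using linked_edge[of x y] by auto
  show "(\<lambda>\<tau>. \<tau> - {{x, y}}) ` {\<tau> \<in> \<Gamma>. {x, y} \<in> \<tau>} \<subseteq> {F \<in> \<Phi>. \<not> linked F x y}"
    using bridge by (auto simp: \<Phi>_def)
  show "insert {x, y} ` {F \<in> \<Phi>. \<not> linked F x y} \<subseteq> {\<tau> \<in> \<Gamma>. {x, y} \<in> \<tau>}"
    using spanning_tree_of_forest[OF _ assms] by auto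
qed

lemma sum_trees_remove_edge:
  fixes g :: "'a set set \<Rightarrow> real"
  assumes "{x, y} \<in> E"
  shows "(\<Sum>\<tau> | \<tau> \<in> \<Gamma> \<and> {x, y} \<in> \<tau>. g (\<tau> - {{x, y}})) = (\<Sum>F | F \<in> \<Phi> \<and> \<not> linked F x y. g F)"
  using sum.reindex_bij_betw[OF bij_remove_edge[OF assms], of g] .

section \<open>Paths in a spanning tree\<close>

text \<open>The parts of the path before and after the arc avoid its edge. Conversely, a path
  without the arc either crosses the edge backwards, putting \<open>u\<close> on the side of
  \<open>y\<close>, or avoids it and links \<open>u\<close> to \<open>v\<close> without it; both
  contradict that the edge is a bridge. The right-hand side speaks only of the forest left by the
  deletion, so the path can be eliminated from later sums.\<close>

lemma path_arc_iff:
  assumes t: "\<tau> \<in> \<Gamma>" and p: "is_simple_path \<tau> u p v"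
  shows "(x, y) \<in> arcs p \<longleftrightarrow>
    {x, y} \<in> \<tau> \<and> linked (\<tau> - {{x, y}}) u x \<and> linked (\<tau> - {{x, y}}) y v"
proof
  assume a: "(x, y) \<in> arcs p"
  then obtain p1 p2 where s: "p = p1 @ x # y # p2" by (blast dest: arcs_split)
  have A: "arcs (p1 @ [x]) \<subseteq> adj \<tau>" "arcs (y # p2) \<subseteq> adj \<tau>"
    using p arcs_append[of p1 x "y # p2"] s by (auto simp: is_simple_path_def)
  have d: "y \<notin> set (p1 @ [x])" "x \<notin> set (y # p2)" using p s by (auto simp: is_simple_path_def)
  have "linked (\<tau> - {{x, y}}) (hd (p1 @ [x])) (last (p1 @ [x]))"
    using A d by (intro path_linked_avoiding) auto
  moreover have "hd (p1 @ [x]) = u" using p s by (cases p1) (auto simp: is_simple_path_def)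
  moreover have "linked (\<tau> - {{x, y}}) (hd (y # p2)) (last (y # p2))"
    using A d by (intro path_linked_avoiding) auto
  moreover have "last (y # p2) = v" using p s by (auto simp: is_simple_path_def)
  moreover have "{x, y} \<in> \<tau>" using a p by (auto simp: is_simple_path_def adj_def)
  ultimately show "{x, y} \<in> \<tau> \<and> linked (\<tau> - {{x, y}}) u x \<and> linked (\<tau> - {{x, y}}) y v"
    by simp
next
  assume a: "{x, y} \<in> \<tau> \<and> linked (\<tau> - {{x, y}}) u x \<and> linked (\<tau> - {{x, y}}) y v"
  have n: "\<not> linked (\<tau> - {{x, y}}) x y" using a t bridge by blast
  show "(x, y) \<in> arcs p"
  proof (rule ccontr)
    assume na: "(x, y) \<notin> arcs p"
    show False
    proof (cases "(y, x) \<in> arcs p")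
      case True
      then obtain p1 p2 where s: "p = p1 @ y # x # p2" by (blast dest: arcs_split)
      have "linked (\<tau> - {{x, y}}) (hd (p1 @ [y])) (last (p1 @ [y]))"
        using p arcs_append[of p1 y "x # p2"] s
        by (intro path_linked_avoiding) (auto simp: is_simple_path_def)
      moreover have "hd (p1 @ [y]) = u" using p s by (cases p1) (auto simp: is_simple_path_def)
      ultimately have "linked (\<tau> - {{x, y}}) u y" by simp
      then show False using a n linked_common[of u x _ y] by blast
    next
      case False
      have "arcs p \<subseteq> adj (\<tau> - {{x, y}})"
      proof safe
        fix b c assume bc: "(b, c) \<in> arcs p"
        then have "{b, c} \<noteq> {x, y}" using na False by (auto simp: doubleton_eq_iff)
        then show "(b, c) \<in> adj (\<tau> - {{x, y}})"
          using bc p by (auto simp: is_simple_path_def adj_def)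
      qed
      then have "linked (\<tau> - {{x, y}}) u v"
        using linked_hd_last[of p] p by (auto simp: is_simple_path_def)
      then have "linked (\<tau> - {{x, y}}) x v" using a linked_common[of u x] by blast
      then show False using a n linked_trans[of x v _ y] linked_sym[of y v] by blast
    qed
  qed
qed

text \<open>By \<open>path_arc_iff\<close> all simple paths between two vertices of a tree have the
  same arcs, so the description in \<open>tree_path\<close> has a unique solution.\<close>

lemma tree_path_is_simple_path:
  assumes t: "\<tau> \<in> \<Gamma>" and V: "u \<in> V" "v \<in> V"
  shows "is_simple_path \<tau> u (tree_path \<tau> u v) v"
proof -
  have "linked \<tau> u v" using t V by (auto simp: spanning_tree_iff connected_graph_def)
  then obtain p where p: "is_simple_path \<tau> u p v" by (rule linked_imp_simple_path)
  have "q = p" if q: "is_simple_path \<tau> u q v" for q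
  proof (rule simple_path_eqI)
    show "arcs q = arcs p" using path_arc_iff[OF t p] path_arc_iff[OF t q] by auto
  qed (use p q in \<open>auto simp: is_simple_path_def\<close>)
  then show ?thesis unfolding tree_path_def using p by (rule theI[rotated])
qed

section \<open>The separated volume\<close>

text \<open>An indicator sum over all of \<open>V\<close> has an index set independent of
  \<open>F\<close>, so it can be exchanged with sums over edges and forests.\<close>

lemma vol_component:
  assumes F: "F \<in> \<Phi>" and x: "x \<in> V"
  shows "real (vol E (component F x)) = (\<Sum>z\<in>V. deg z * of_bool (linked F x z))"
proof -
  have FE: "F \<subseteq> E" using F by (auto simp: \<Phi>_def spanning_tree_iff)
  have "z \<in> V" if "linked F x z" for z
    using that x by (cases rule: rtrancl.cases) (use FE edgeD in \<open>auto simp: adj_def\<close>)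
  then have "component F x = {z \<in> V. linked F x z}"
    by (auto simp: component_def)
  then have "real (vol E (component F x)) = (\<Sum>z\<in>{z \<in> V. linked F x z}. deg z)"
    by (simp add: vol_def)
  also have "\<dots> = (\<Sum>z\<in>V. deg z * of_bool (linked F x z))"
    using finite_V by (simp add: sum.inter_filter of_bool_def if_distrib cong: if_cong)
  finally show ?thesis .
qed

abbreviation fvol :: "'a set set \<Rightarrow> 'a \<Rightarrow> real" where
  "fvol F x \<equiv> real (vol E (component F x))"

lemma fvol_cong:
  assumes "linked F x y" shows "fvol F x = fvol F y"
proof -
  have "component F x = component F y"
    using assms linked_sym[OF assms] by (auto simp: component_def intro: linked_trans)
  then show ?thesis by simp
qed

lemma fvol_add:
  assumes F: "F \<in> \<Phi>" and V: "x \<in> V" "y \<in> V" and n: "\<not> linked F x y"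
  shows "fvol F x + fvol F y = real (vol E V)"
proof -
  have "fvol F x + fvol F y =
      (\<Sum>z\<in>V. deg z * of_bool (linked F x z) + deg z * of_bool (linked F y z))"
    by (simp add: vol_component[OF F] V sum.distrib)
  also have "\<dots> = (\<Sum>z\<in>V. deg z)"
    using forest_two_trees[OF F V _ n] by (intro sum.cong) auto
  finally show ?thesis by (simp add: vol_def)
qed

text \<open>This is \<open>card \<Gamma>\<close> times the expected hitting time from
  \<open>x\<close> to \<open>u\<close>, as \<open>expected_hitting_time_eq\<close> shows.\<close>

definition sep_vol :: "'a \<Rightarrow> 'a \<Rightarrow> real" where
  "sep_vol x u = (\<Sum>F\<in>\<Phi>. fvol F x * of_bool (\<not> linked F x u))"

lemma sep_vol_same [simp]: "sep_vol u u = 0"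
  by (simp add: sep_vol_def)

lemma sep_vol_nonneg: "0 \<le> sep_vol x u"
  unfolding sep_vol_def by (intro sum_nonneg) auto

section \<open>Branches of a tree and the Laplacian of the separated volume\<close>

text \<open>For a path starting in \<open>x\<close>, \<open>path_arc_iff\<close> says that the
  branch behind \<open>y\<close> contains \<open>w\<close> iff \<open>(x, y)\<close> is an arc of
  the tree path to \<open>w\<close>. Only its first arc leaves \<open>x\<close>, and for
  \<open>w = x\<close> there is none.\<close>

lemma tree_branch:
  assumes t: "\<tau> \<in> \<Gamma>" and V: "x \<in> V" "w \<in> V"
  shows "(\<Sum>y | y \<in> V \<and> {x, y} \<in> \<tau>. of_bool (linked (\<tau> - {{x, y}}) y w)) = (of_bool (x \<noteq> w) :: real)"
proof -
  let ?p = "tree_path \<tau> x w"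
  have p: "is_simple_path \<tau> x ?p w" using t V by (rule tree_path_is_simple_path)
  have fin: "finite {y. y \<in> V \<and> {x, y} \<in> \<tau>}" using finite_V by auto
  have iff: "linked (\<tau> - {{x, y}}) y w \<longleftrightarrow> (x, y) \<in> arcs ?p" if "{x, y} \<in> \<tau>" for y
    using path_arc_iff[OF t p, of x y] that by simp
  show ?thesis
  proof (cases "x = w")
    case True
    then have "\<not> linked (\<tau> - {{x, y}}) y w" if "{x, y} \<in> \<tau>" for y
      using bridge[OF t that] linked_sym[of y x] that by blast
    then show ?thesis using True by (auto intro!: sum.neutral)
  next
    case False
    then obtain y0 q where q: "?p = x # y0 # q"
      using p by (cases ?p; cases "tl ?p") (auto simp: is_simple_path_def)
    have a: "(x, y) \<in> arcs ?p \<longleftrightarrow> y = y0" for y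
      using p arcsD[of x y "y0 # q"] by (auto simp: q is_simple_path_def)
    have "{x, y0} \<in> \<tau>" using a[of y0] path_arc_iff[OF t p, of x y0] by auto
    moreover have "y0 \<in> V" using calculation t edgeD[of x y0] by (auto simp: spanning_tree_iff)
    moreover have "(\<Sum>y | y \<in> V \<and> {x, y} \<in> \<tau>. of_bool (linked (\<tau> - {{x, y}}) y w)) =
        (\<Sum>y | y \<in> V \<and> {x, y} \<in> \<tau>. if y = y0 then 1 else (0::real))"
      by (intro sum.cong) (auto simp: iff a)
    ultimately show ?thesis using False fin by simp
  qed
qed

lemma neighbours_V: "neighbours E x = {y \<in> V. {x, y} \<in> E}"
  using edgeD by (auto simp: neighbours_def)

text \<open>The first-step equation of the hitting times, multiplied by \<open>card \<Gamma>\<close>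
  and \<open>deg x\<close>. Each difference is rewritten as a sum over the trees containing the
  edge; exchanging the sums leaves a contribution of \<open>deg x\<close> from every tree.\<close>

lemma sep_vol_laplacian:
  assumes V: "x \<in> V" "u \<in> V" and ne: "x \<noteq> u"
  shows "(\<Sum>y\<in>neighbours E x. sep_vol x u - sep_vol y u) = card \<Gamma> * deg x"
proof -
  let ?W = "real (vol E V)"
  have diff: "sep_vol x u - sep_vol y u =
      (\<Sum>\<tau> | \<tau> \<in> \<Gamma> \<and> {x, y} \<in> \<tau>. ?W * of_bool (linked (\<tau> - {{x, y}}) y u) - fvol (\<tau> - {{x, y}}) y)"
    if y: "y \<in> V" "{x, y} \<in> E" for y
  proof -
    have "sep_vol x u - sep_vol y u =
        (\<Sum>F\<in>\<Phi>. fvol F x * of_bool (\<not> linked F x u) - fvol F y * of_bool (\<not> linked F y u))"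
      by (simp add: sep_vol_def sum_subtractf)
    \<comment> \<open>Forests joining \<open>x\<close> and \<open>y\<close> cancel. In the others
      \<open>u\<close> lies in exactly one tree: in that of \<open>y\<close> the term is
      \<open>fvol F x = ?W - fvol F y\<close>, in that of \<open>x\<close> it is
      \<open>- fvol F y\<close>.\<close>
    also have "\<dots> = (\<Sum>F\<in>\<Phi>. if \<not> linked F x y then ?W * of_bool (linked F y u) - fvol F y else 0)"
    proof (intro sum.cong refl)
      fix F assume F: "F \<in> \<Phi>"
      show "fvol F x * of_bool (\<not> linked F x u) - fvol F y * of_bool (\<not> linked F y u) =
          (if \<not> linked F x y then ?W * of_bool (linked F y u) - fvol F y else 0)"
      proof (cases "linked F x y")
        case True
        then have "linked F x u \<longleftrightarrow> linked F y u"
          using linked_common[of x y F u] linked_trans[of x y F u] by blast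
        then show ?thesis using fvol_cong[OF True] True by simp
      next
        case False
        show ?thesis
          using forest_two_trees[OF F V(1) y(1) V(2) False] fvol_add[OF F V(1) y(1) False] False
          by auto
      qed
    qed
    also have "\<dots> = (\<Sum>F | F \<in> \<Phi> \<and> \<not> linked F x y. ?W * of_bool (linked F y u) - fvol F y)"
      by (rule sum.inter_filter[symmetric]) (rule finite_\<Phi>)
    also have "\<dots> = (\<Sum>\<tau> | \<tau> \<in> \<Gamma> \<and> {x, y} \<in> \<tau>.
        ?W * of_bool (linked (\<tau> - {{x, y}}) y u) - fvol (\<tau> - {{x, y}}) y)"
      by (rule sum_trees_remove_edge[symmetric]) (rule y)
    finally show ?thesis .
  qed
  \<comment> \<open>The branches of the tree at \<open>x\<close> partition the other vertices, so
    their volumes add up to \<open>?W - deg x\<close>; exactly one branch contains \<open>u\<close>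
    and contributes \<open>?W\<close>.\<close>
  have per_tree: "(\<Sum>y | y \<in> V \<and> {x, y} \<in> \<tau>.
      ?W * of_bool (linked (\<tau> - {{x, y}}) y u) - fvol (\<tau> - {{x, y}}) y) = deg x"
    if t: "\<tau> \<in> \<Gamma>" for \<tau>
  proof -
    have Phi: "\<tau> - {{x, y}} \<in> \<Phi>" if "{x, y} \<in> \<tau>" for y
      using t that by (auto simp: \<Phi>_def)
    have "(\<Sum>y | y \<in> V \<and> {x, y} \<in> \<tau>. fvol (\<tau> - {{x, y}}) y) =
        (\<Sum>y | y \<in> V \<and> {x, y} \<in> \<tau>. \<Sum>z\<in>V. deg z * of_bool (linked (\<tau> - {{x, y}}) y z))"
      using Phi by (intro sum.cong) (auto simp: vol_component)
    also have "\<dots> = (\<Sum>z\<in>V. deg z * of_bool (x \<noteq> z))"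
      using tree_branch[OF t V(1)] by (subst sum.swap) (simp flip: sum_distrib_left)
    also have "\<dots> = (\<Sum>z\<in>V. deg z - (if x = z then deg z else 0))"
      by (intro sum.cong) auto
    also have "\<dots> = ?W - deg x"
      using finite_V V by (simp add: sum_subtractf vol_def)
    finally show ?thesis
      using tree_branch[OF t V] ne by (simp add: sum_subtractf flip: sum_distrib_left)
  qed
  have "(\<Sum>y\<in>neighbours E x. sep_vol x u - sep_vol y u) =
      (\<Sum>y | y \<in> V \<and> {x, y} \<in> E. \<Sum>\<tau> | \<tau> \<in> \<Gamma> \<and> {x, y} \<in> \<tau>.
        ?W * of_bool (linked (\<tau> - {{x, y}}) y u) - fvol (\<tau> - {{x, y}}) y)"
    unfolding neighbours_V by (intro sum.cong) (auto simp: diff)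
  also have "\<dots> = (\<Sum>\<tau>\<in>\<Gamma>. \<Sum>y | y \<in> {y \<in> V. {x, y} \<in> E} \<and> {x, y} \<in> \<tau>.
        ?W * of_bool (linked (\<tau> - {{x, y}}) y u) - fvol (\<tau> - {{x, y}}) y)"
    by (rule sum.swap_restrict) (use finite_V finite_\<Gamma> in auto)
  also have "\<dots> = (\<Sum>\<tau>\<in>\<Gamma>. deg x)"
  proof (intro sum.cong refl)
    fix \<tau> assume t: "\<tau> \<in> \<Gamma>"
    then have "{y. y \<in> {y \<in> V. {x, y} \<in> E} \<and> {x, y} \<in> \<tau>} = {y. y \<in> V \<and> {x, y} \<in> \<tau>}"
      by (auto simp: spanning_tree_iff)
    then show "(\<Sum>y | y \<in> {y \<in> V. {x, y} \<in> E} \<and> {x, y} \<in> \<tau>.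
        ?W * of_bool (linked (\<tau> - {{x, y}}) y u) - fvol (\<tau> - {{x, y}}) y) = deg x"
      using per_tree[OF t] by simp
  qed
  finally show ?thesis by simp
qed

section \<open>Degree-weighted sums of the separated volume\<close>

text \<open>For a fixed forest, the degrees of the vertices \<open>u\<close> separated from
  \<open>x\<close> add up to the volume of the tree without \<open>x\<close>.\<close>

lemma weighted_sep_vol:
  assumes x: "x \<in> V"
  shows "(\<Sum>u\<in>V. deg u * sep_vol x u) = (\<Sum>F\<in>\<Phi>. fvol F x * (real (vol E V) - fvol F x))"
proof -
  have "(\<Sum>u\<in>V. deg u * sep_vol x u) =
      (\<Sum>F\<in>\<Phi>. \<Sum>u\<in>V. fvol F x * (deg u - deg u * of_bool (linked F x u)))"
    unfolding sep_vol_def sum_distrib_left by (subst sum.swap) (auto intro!: sum.cong)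
  also have "\<dots> = (\<Sum>F\<in>\<Phi>. fvol F x * (real (vol E V) - fvol F x))"
  proof (intro sum.cong refl)
    fix F assume F: "F \<in> \<Phi>"
    show "(\<Sum>u\<in>V. fvol F x * (deg u - deg u * of_bool (linked F x u))) =
        fvol F x * (real (vol E V) - fvol F x)"
      unfolding sum_distrib_left[symmetric] sum_subtractf vol_component[OF F x, symmetric]
      by (simp add: vol_def)
  qed
  finally show ?thesis .
qed

text \<open>Moving from \<open>x\<close> to \<open>y\<close> at most swaps the volumes of the two
  trees, and their product is symmetric. This is the independence of the Kemeny constant from the
  starting vertex.\<close>

lemma weighted_sep_vol_const:
  assumes V: "x \<in> V" "y \<in> V"
  shows "(\<Sum>u\<in>V. deg u * sep_vol x u) = (\<Sum>u\<in>V. deg u * sep_vol y u)"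
  unfolding weighted_sep_vol[OF V(1)] weighted_sep_vol[OF V(2)]
proof (intro sum.cong refl)
  fix F assume F: "F \<in> \<Phi>"
  show "fvol F x * (real (vol E V) - fvol F x) = fvol F y * (real (vol E V) - fvol F y)"
  proof (cases "linked F x y")
    case True
    then show ?thesis by (simp add: fvol_cong)
  next
    case False
    show ?thesis unfolding fvol_add[OF F V False, symmetric] by (simp add: algebra_simps)
  qed
qed

section \<open>The statistic summed over all spanning trees\<close>

text \<open>Membership in the tree path becomes a condition on the forest left by the deletion;
  then, arc by arc, trees containing the edge are exchanged for forests separating its ends. The arc
  set \<open>A\<close> is general so that it covers the arcs of a path as well as their
  reversals.\<close>

lemma sum_forests_along_path:
  fixes g :: "'a set set \<Rightarrow> real"
  assumes V: "u \<in> V" "r \<in> V" and A: "finite A" "A \<subseteq> adj E"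
  shows "(\<Sum>\<tau>\<in>\<Gamma>. \<Sum>F\<in>{\<tau> - {{x, y}} | x y. (x, y) \<in> A \<and> (x, y) \<in> arcs (tree_path \<tau> u r)}. g F) =
    (\<Sum>(x, y)\<in>A. \<Sum>F\<in>\<Phi>. g F * of_bool (\<not> linked F x y \<and> linked F u x \<and> linked F y r))"
proof -
  have inner: "(\<Sum>F\<in>{\<tau> - {{x, y}} | x y. (x, y) \<in> A \<and> (x, y) \<in> arcs (tree_path \<tau> u r)}. g F) =
      (\<Sum>a | a \<in> A \<and> {fst a, snd a} \<in> \<tau>. g (\<tau> - {{fst a, snd a}}) *
        of_bool (linked (\<tau> - {{fst a, snd a}}) u (fst a) \<and> linked (\<tau> - {{fst a, snd a}}) (snd a) r))"
    (is "sum g ?L = _") if t: "\<tau> \<in> \<Gamma>" for \<tau>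
  proof -
    let ?p = "tree_path \<tau> u r"
    let ?h = "\<lambda>a. \<tau> - {{fst a, snd a}}"
    note arc = path_arc_iff[OF t tree_path_is_simple_path[OF t V]]
    have L: "?L = ?h ` (A \<inter> arcs ?p)" by force
    \<comment> \<open>The forests form a set, so no two arcs may yield the same one. Equal forests
      come from the same edge, and opposite directions would put \<open>u\<close> on both sides of
      it.\<close>
    have inj: "inj_on ?h (A \<inter> arcs ?p)"
    proof (rule inj_onI)
      fix a b assume a: "a \<in> A \<inter> arcs ?p" and b: "b \<in> A \<inter> arcs ?p" and eq: "?h a = ?h b"
      obtain x y x' y' where ab: "a = (x, y)" "b = (x', y')" by fastforce
      have xy: "{x, y} \<in> \<tau>" "linked (\<tau> - {{x, y}}) u x" using a arc[of x y] ab by auto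
      have xy': "{x', y'} \<in> \<tau>" "linked (\<tau> - {{x', y'}}) u x'" using b arc[of x' y'] ab by auto
      have e: "{x, y} = {x', y'}" using eq xy(1) xy'(1) ab by auto
      moreover have "x' \<noteq> y"
        using linked_common[OF xy(2)] xy'(2) e bridge[OF t xy(1)] by auto
      ultimately show "a = b" using ab by (auto simp: doubleton_eq_iff)
    qed
    have "sum g ?L = (\<Sum>a\<in>A \<inter> arcs ?p. g (?h a))"
      unfolding L using sum.reindex[OF inj] by simp
    also have "\<dots> = (\<Sum>a | a \<in> A \<and> {fst a, snd a} \<in> \<tau>. g (?h a) *
        of_bool (linked (?h a) u (fst a) \<and> linked (?h a) (snd a) r))"
      using A(1) arc by (intro sum.mono_neutral_cong_left) auto
    finally show ?thesis .
  qed
  have "(\<Sum>\<tau>\<in>\<Gamma>. \<Sum>F\<in>{\<tau> - {{x, y}} | x y. (x, y) \<in> A \<and> (x, y) \<in> arcs (tree_path \<tau> u r)}. g F) =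
      (\<Sum>\<tau>\<in>\<Gamma>. \<Sum>a | a \<in> A \<and> {fst a, snd a} \<in> \<tau>. g (\<tau> - {{fst a, snd a}}) *
        of_bool (linked (\<tau> - {{fst a, snd a}}) u (fst a) \<and> linked (\<tau> - {{fst a, snd a}}) (snd a) r))"
    by (intro sum.cong refl inner)
  also have "\<dots> = (\<Sum>a\<in>A. \<Sum>\<tau> | \<tau> \<in> \<Gamma> \<and> {fst a, snd a} \<in> \<tau>. g (\<tau> - {{fst a, snd a}}) *
        of_bool (linked (\<tau> - {{fst a, snd a}}) u (fst a) \<and> linked (\<tau> - {{fst a, snd a}}) (snd a) r))"
    by (rule sum.swap_restrict) (use A finite_\<Gamma> in auto)
  also have "\<dots> = (\<Sum>a\<in>A. \<Sum>F\<in>\<Phi>. g F *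
      of_bool (\<not> linked F (fst a) (snd a) \<and> linked F u (fst a) \<and> linked F (snd a) r))"
  proof (rule sum.cong[OF refl])
    fix a assume "a \<in> A"
    then have e: "{fst a, snd a} \<in> E" using A(2) by (auto simp: adj_def)
    show "(\<Sum>\<tau> | \<tau> \<in> \<Gamma> \<and> {fst a, snd a} \<in> \<tau>. g (\<tau> - {{fst a, snd a}}) *
        of_bool (linked (\<tau> - {{fst a, snd a}}) u (fst a) \<and> linked (\<tau> - {{fst a, snd a}}) (snd a) r)) =
      (\<Sum>F\<in>\<Phi>. g F * of_bool (\<not> linked F (fst a) (snd a) \<and> linked F u (fst a) \<and> linked F (snd a) r))"
      unfolding sum_trees_remove_edge[OF e, where
          g = "\<lambda>F. g F * of_bool (linked F u (fst a) \<and> linked F (snd a) r)"]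
        sum.inter_filter[OF finite_\<Phi>]
      by (intro sum.cong) auto
  qed
  finally show ?thesis by (simp add: case_prod_unfold)
qed

lemma sum_fwd_minus_bwd:
  assumes V: "u \<in> V" "r \<in> V" and P: "is_simple_path E u P r"
  shows "(\<Sum>\<tau>\<in>\<Gamma>. (\<Sum>F\<in>forests_fwd P u r \<tau>. fvol F r) - (\<Sum>F\<in>forests_bwd P u r \<tau>. fvol F r)) = sep_vol r u"
proof -
  let ?i = "\<lambda>F x y. of_bool (\<not> linked F x y \<and> linked F u x \<and> linked F y r) :: real"
  have sub: "arcs P \<subseteq> adj E" using P by (simp add: is_simple_path_def)
  have "(\<Sum>\<tau>\<in>\<Gamma>. \<Sum>F\<in>forests_fwd P u r \<tau>. fvol F r) =
      (\<Sum>(x, y)\<in>arcs P. \<Sum>F\<in>\<Phi>. fvol F r * ?i F x y)"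
    unfolding forests_fwd_def using V sub by (intro sum_forests_along_path) auto
  moreover have "(\<Sum>\<tau>\<in>\<Gamma>. \<Sum>F\<in>forests_bwd P u r \<tau>. fvol F r) =
      (\<Sum>(x, y)\<in>arcs P. \<Sum>F\<in>\<Phi>. fvol F r * ?i F y x)"
  proof -
    \<comment> \<open>Backward forests are forward forests for the reversed arcs.\<close>
    have "forests_bwd P u r \<tau> =
        {\<tau> - {{x, y}} | x y. (x, y) \<in> (arcs P)\<inverse> \<and> (x, y) \<in> arcs (tree_path \<tau> u r)}" for \<tau>
      unfolding forests_bwd_def by (auto simp: insert_commute)
    then have "(\<Sum>\<tau>\<in>\<Gamma>. \<Sum>F\<in>forests_bwd P u r \<tau>. fvol F r) =
        (\<Sum>(x, y)\<in>(arcs P)\<inverse>. \<Sum>F\<in>\<Phi>. fvol F r * ?i F x y)"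
      using V sub by (simp only:, intro sum_forests_along_path) (auto simp: adj_def insert_commute)
    also have "\<dots> = (\<Sum>(x, y)\<in>arcs P. \<Sum>F\<in>\<Phi>. fvol F r * ?i F y x)"
      by (rule sum.reindex_bij_witness[of _ prod.swap prod.swap]) auto
    finally show ?thesis .
  qed
  ultimately have "(\<Sum>\<tau>\<in>\<Gamma>. (\<Sum>F\<in>forests_fwd P u r \<tau>. fvol F r) - (\<Sum>F\<in>forests_bwd P u r \<tau>. fvol F r))
      = (\<Sum>(x, y)\<in>arcs P. \<Sum>F\<in>\<Phi>. fvol F r * (?i F x y - ?i F y x))"
    by (simp add: sum_subtractf case_prod_unfold right_diff_distrib)
  also have "\<dots> = (\<Sum>F\<in>\<Phi>. fvol F r * (\<Sum>(x, y)\<in>arcs P. ?i F x y - ?i F y x))"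
    unfolding case_prod_unfold sum_distrib_left by (rule sum.swap)
  also have "\<dots> = sep_vol r u"
    unfolding sep_vol_def
  proof (intro sum.cong refl arg_cong2[of _ _ _ _ "(*)"])
    fix F assume F: "F \<in> \<Phi>"
    show "(\<Sum>(x, y)\<in>arcs P. ?i F x y - ?i F y x) = of_bool (\<not> linked F r u)"
    proof (cases "linked F r u")
      case True
      \<comment> \<open>If \<open>u\<close> and \<open>r\<close> share a tree, \<open>x\<close> and
        \<open>y\<close> are linked through them, so all indicators vanish.\<close>
      have "linked F x y" if "linked F u x" "linked F y r" for x y
        using that(1) linked_trans[OF linked_sym[OF True] linked_sym[OF that(2)]]
        by (rule linked_common)
      then have "?i F x y = 0" for x y by auto
      then show ?thesis using True by (simp only: diff_self case_prod_unfold sum.neutral_const) simp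
    next
      case False
      then have n: "\<not> linked F u r" using linked_sym[of u r F] by blast
      let ?l = "\<lambda>x. of_bool (linked F u x) :: real"
      \<comment> \<open>With only two trees, the tree of \<open>r\<close> is the complement of that
        of \<open>u\<close>: the arc contributes iff it leaves the tree of \<open>u\<close>.\<close>
      have one: "?i F x y = ?l x * (1 - ?l y)" if "x \<in> V" "y \<in> V" for x y
      proof -
        have "linked F y r \<longleftrightarrow> \<not> linked F u y"
          using forest_two_trees[OF F V \<open>y \<in> V\<close> n] linked_sym[of y r F] linked_sym[of r y F] by blast
        moreover have "\<not> linked F x y" if "linked F u x" "\<not> linked F u y"
          using that linked_trans[of u x F y] by blast
        ultimately show ?thesis by auto
      qed
      \<comment> \<open>The products cancel in the difference, and the rest telescopes to
        \<open>?l u - ?l r\<close>, which is one.\<close>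
      have "(\<Sum>(x, y)\<in>arcs P. ?i F x y - ?i F y x) = (\<Sum>(x, y)\<in>arcs P. ?l x - ?l y)"
      proof (intro sum.cong refl, clarify)
        fix x y assume "(x, y) \<in> arcs P"
        then have "{x, y} \<in> E" using sub by (auto simp: adj_def)
        then have xy: "x \<in> V" "y \<in> V" using edgeD by auto
        show "?i F x y - ?i F y x = ?l x - ?l y"
          unfolding one[OF xy] one[OF xy(2,1)] by simp
      qed
      also have "\<dots> = ?l u - ?l r"
        using sum_arcs_telescope[of P ?l] P by (simp add: is_simple_path_def)
      finally show ?thesis using n False by simp
    qed
  qed
  finally show ?thesis .
qed

lemma sum_tree_stat:
  assumes r: "r \<in> V" and P: "\<And>u. u \<in> V - {r} \<Longrightarrow> is_simple_path E u (P u) r"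
  shows "(\<Sum>\<tau>\<in>\<Gamma>. tree_stat V E r P \<tau>) = (\<Sum>u\<in>V. deg u * sep_vol r u)"
proof -
  have "(\<Sum>\<tau>\<in>\<Gamma>. tree_stat V E r P \<tau>) = (\<Sum>u\<in>V - {r}. deg u * sep_vol r u)"
    unfolding tree_stat_def
    by (subst sum.swap) (auto simp: r P sum_fwd_minus_bwd simp flip: sum_distrib_left intro!: sum.cong)
  also have "\<dots> = (\<Sum>u\<in>V. deg u * sep_vol r u)"
    using finite_V by (intro sum.mono_neutral_left) auto
  finally show ?thesis .
qed

end

section \<open>Hitting times\<close>

lemma hitting_time_self [simp]: "hitting_time i i s = 0"
proof -
  have "hitting_time i i s \<le> of_nat 0"
    unfolding hitting_time_def by (rule INF_lower) simp
  then show ?thesis by simp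
qed

text \<open>With \<open>top\<close> at the times when the walk is elsewhere, the index set no longer
  depends on \<open>s\<close>; measurability and the shift by one step rely on this.\<close>

lemma hitting_time_alt: "hitting_time i j s = (INF n. if walk i s n = j then of_nat n else top)"
  unfolding hitting_time_def
proof (intro antisym INF_greatest)
  fix n
  show "(INF n\<in>{n. walk i s n = j}. of_nat n) \<le> (if walk i s n = j then of_nat n else top :: ennreal)"
    by (auto intro: INF_lower)
next
  fix n assume "n \<in> {n. walk i s n = j}"
  then show "(INF n. if walk i s n = j then of_nat n else top :: ennreal) \<le> of_nat n"
    by (intro INF_lower2[of n]) auto
qed

text \<open>Time \<open>0\<close> contributes \<open>top\<close> because
  \<open>i \<noteq> j\<close>; from time one on, the walk is the one from \<open>f i\<close> driven
  by \<open>s\<close>.\<close>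

lemma hitting_time_SCons:
  assumes "i \<noteq> j"
  shows "hitting_time i j (f ## s) = 1 + hitting_time (f i) j s"
proof -
  let ?a = "\<lambda>n. if walk i (f ## s) n = j then of_nat n else top :: ennreal"
  have "hitting_time i j (f ## s) = (INF n\<in>insert 0 (range Suc). ?a n)"
    unfolding hitting_time_alt by (simp only: UNIV_nat_eq[symmetric])
  also have "\<dots> = (INF n. ?a (Suc n))"
    unfolding INF_insert image_image using assms by simp
  also have "\<dots> = (INF n. 1 + (if walk (f i) s n = j then of_nat n else top))"
    by (intro INF_cong) (auto simp: walk_SCons simp del: walk.simps(2))
  finally show ?thesis by (simp add: hitting_time_alt INF_ennreal_const_add)
qed

context fin_connected_graph begin

text \<open>The value at \<open>x\<close> of a uniform random map is a uniform neighbour: each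
  neighbour is taken by equally many maps, namely the product of the degrees of the other
  vertices.\<close>

lemma nn_integral_random_map:
  fixes g :: "'a \<Rightarrow> ennreal"
  assumes ni: "\<And>v. v \<in> V \<Longrightarrow> neighbours E v \<noteq> {}" and x: "x \<in> V"
  shows "(\<integral>\<^sup>+ f. g (f x) \<partial>uniform_count_measure (\<Pi>\<^sub>E v\<in>V. neighbours E v)) =
    (\<Sum>y\<in>neighbours E x. ennreal (1 / deg x) * g y)"
proof -
  let ?N = "neighbours E" and ?A = "\<Pi>\<^sub>E v\<in>V. neighbours E v"
  note fin = neighbours_finite_subset(1)[OF simple]
  have finA: "finite ?A" using fin finite_V by (intro finite_PiE) auto
  let ?k = "\<Prod>v\<in>V - {x}. card (?N v)"
  have k: "?k \<noteq> 0" using ni fin finite_V by auto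
  have cA: "card ?A = card (?N x) * ?k"
    using finite_V x by (simp add: card_PiE prod.remove)
  have c: "card {f \<in> ?A. f x = y} = ?k" if y: "y \<in> ?N x" for y
  proof -
    have "{f \<in> ?A. f x = y} = (\<Pi>\<^sub>E v\<in>V. (?N(x := {y})) v)"
      using x y by (auto simp: PiE_iff extensional_def split: if_splits)
    then show ?thesis
      using finite_V x by (simp add: card_PiE prod.remove[OF finite_V x])
  qed
  have "(\<integral>\<^sup>+ f. g (f x) \<partial>uniform_count_measure ?A) = (\<Sum>f\<in>?A. ennreal (1 / card ?A) * g (f x))"
    unfolding uniform_count_measure_def by (simp add: nn_integral_point_measure_finite[OF finA])
  also have "\<dots> = (\<Sum>y\<in>?N x. \<Sum>f | f \<in> ?A \<and> f x = y. ennreal (1 / card ?A) * g (f x))"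
    using x by (intro sum.group[symmetric] finA fin) auto
  also have "\<dots> = (\<Sum>y\<in>?N x. ennreal (1 / deg x) * g y)"
  proof (rule sum.cong[OF refl])
    fix y assume y: "y \<in> ?N x"
    have "(\<Sum>f | f \<in> ?A \<and> f x = y. ennreal (1 / card ?A) * g (f x)) =
        (of_nat ?k * ennreal (1 / card ?A)) * g y"
      using c[OF y] by (simp add: mult.assoc del: of_nat_prod)
    also have "of_nat ?k * ennreal (1 / card ?A) = ennreal (real ?k * (1 / card ?A))"
      by (subst ennreal_mult) (auto simp: ennreal_of_nat_eq_real_of_nat simp del: of_nat_prod)
    also have "real ?k * (1 / card ?A) = 1 / deg x"
      using k unfolding cA vertex_degree_def by (simp del: of_nat_prod prod_zero_iff)
    finally show "(\<Sum>f | f \<in> ?A \<and> f x = y. ennreal (1 / card ?A) * g (f x)) = ennreal (1 / deg x) * g y" .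
  qed
  finally show ?thesis .
qed

lemma no_isolated:
  assumes "v \<in> V" "w \<in> V" "v \<noteq> w" shows "neighbours E v \<noteq> {}"
proof -
  have "linked E v w" using connected assms by (simp add: connected_graph_def)
  then show ?thesis
    using \<open>v \<noteq> w\<close> by (cases rule: converse_rtranclE) (auto simp: adj_def neighbours_def)
qed

text \<open>A step evaluates a random map at a random vertex; as \<open>V\<close> is finite, it
  suffices to treat each fixed vertex.\<close>

lemma measurable_walk:
  assumes "i \<in> V"
  shows "(\<lambda>s. walk i s n) \<in> walk_space V E \<rightarrow>\<^sub>M count_space V"
proof (induction n)
  case 0
  show ?case using assms by simp
next
  case (Suc n)
  let ?U = "uniform_count_measure (\<Pi>\<^sub>E v\<in>V. neighbours E v)"
  have "(\<lambda>s. (s !! n) v) \<in> walk_space V E \<rightarrow>\<^sub>M count_space V" if "v \<in> V" for v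
  proof -
    have "(\<lambda>f. f v) \<in> ?U \<rightarrow>\<^sub>M count_space V"
      using that neighbours_V[of v]
      by (auto simp: measurable_def sets_uniform_count_measure space_uniform_count_measure)
    then show ?thesis
      unfolding walk_space_def by (rule measurable_compose[OF measurable_snth])
  qed
  then show ?case
    using measurable_compose_countable'[OF _ Suc.IH, where f = "\<lambda>v s. (s !! n) v"]
      countable_finite[OF finite_V] by simp
qed

lemma measurable_hitting_time:
  assumes "i \<in> V"
  shows "(\<lambda>s. hitting_time i j s) \<in> borel_measurable (walk_space V E)"
proof -
  have "(\<lambda>s. INF n. if walk i s n = j then of_nat n else top :: ennreal)
      \<in> borel_measurable (walk_space V E)"
  proof (intro borel_measurable_INF measurable_If)
    fix n
    have "(\<lambda>s. walk i s n = j) \<in> walk_space V E \<rightarrow>\<^sub>M count_space UNIV"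
      by (rule measurable_compose[OF measurable_walk[OF assms]]) simp
    then show "{s \<in> space (walk_space V E). walk i s n = j} \<in> sets (walk_space V E)"
      by (simp add: pred_def)
  qed auto
  then show ?thesis by (simp add: hitting_time_alt)
qed

text \<open>First-step analysis with a cutoff that drops by one per step. Finite \<open>c\<close>
  allows an induction before finiteness of the expectation is known; \<open>c = top\<close> gives
  the untruncated equation.\<close>

lemma truncated_hitting_time_step:
  assumes V: "i \<in> V" "j \<in> V" and ne: "i \<noteq> j"
  shows "(\<integral>\<^sup>+ s. min (hitting_time i j s) (1 + c) \<partial>walk_space V E) =
    1 + (\<Sum>y\<in>neighbours E i. ennreal (1 / deg i) * (\<integral>\<^sup>+ s. min (hitting_time y j s) c \<partial>walk_space V E))"
    (is "_ = 1 + (\<Sum>y\<in>_. _ * ?K y)")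
proof -
  let ?A = "\<Pi>\<^sub>E v\<in>V. neighbours E v"
  let ?U = "uniform_count_measure ?A"
  note fin = neighbours_finite_subset(1)[OF simple]
  have ni: "neighbours E v \<noteq> {}" if "v \<in> V" for v
    using no_isolated[OF that V(1)] no_isolated[OF that V(2)] ne by auto
  have "finite ?A" "?A \<noteq> {}" using fin finite_V ni by (auto intro: finite_PiE simp: PiE_eq_empty_iff)
  then interpret U: prob_space ?U by (rule prob_space_uniform_count_measure)
  interpret S: prob_space "walk_space V E"
    unfolding walk_space_def by (rule U.prob_space_stream_space)
  have "(\<integral>\<^sup>+ s. min (hitting_time i j s) (1 + c) \<partial>walk_space V E) =
      (\<integral>\<^sup>+ f. \<integral>\<^sup>+ s. min (hitting_time i j (f ## s)) (1 + c) \<partial>walk_space V E \<partial>?U)"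
    unfolding walk_space_def
    by (intro U.nn_integral_stream_space borel_measurable_min borel_measurable_const
        measurable_hitting_time[OF V(1), unfolded walk_space_def])
  also have "\<dots> = (\<integral>\<^sup>+ f. 1 + ?K (f i) \<partial>?U)"
  proof (rule nn_integral_cong)
    fix f assume "f \<in> space ?U"
    then have "f i \<in> neighbours E i" using V by (auto simp: space_uniform_count_measure)
    then have m: "hitting_time (f i) j \<in> borel_measurable (walk_space V E)"
      by (intro measurable_hitting_time) (simp add: neighbours_V)
    have "min (1 + t) (1 + c) = 1 + min t c" for t
      by (simp add: min_def)
    then have "(\<integral>\<^sup>+ s. min (hitting_time i j (f ## s)) (1 + c) \<partial>walk_space V E) =
        (\<integral>\<^sup>+ s. 1 + min (hitting_time (f i) j s) c \<partial>walk_space V E)"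
      by (simp add: hitting_time_SCons[OF ne])
    also have "\<dots> = 1 + ?K (f i)"
      using m by (simp add: nn_integral_add S.emeasure_space_1)
    finally show "(\<integral>\<^sup>+ s. min (hitting_time i j (f ## s)) (1 + c) \<partial>walk_space V E) = 1 + ?K (f i)" .
  qed
  also have "\<dots> = (\<Sum>y\<in>neighbours E i. ennreal (1 / deg i) * (1 + ?K y))"
    by (rule nn_integral_random_map[OF ni V(1)])
  also have "\<dots> = (\<Sum>y\<in>neighbours E i. ennreal (1 / deg i)) + (\<Sum>y\<in>neighbours E i. ennreal (1 / deg i) * ?K y)"
    by (simp add: distrib_left sum.distrib)
  also have "(\<Sum>y\<in>neighbours E i. ennreal (1 / deg i)) = 1"
    using ni[OF V(1)] fin[of i]
    by (subst sum_ennreal) (auto simp: vertex_degree_def)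
  finally show ?thesis .
qed

section \<open>Uniqueness for the Dirichlet problem\<close>

text \<open>Maximum principle: at a maximum other than \<open>u\<close> the differences are
  nonnegative with sum zero, so all neighbours attain the maximum too. Connectedness carries a
  positive maximum to \<open>u\<close>, where \<open>f\<close> is zero.\<close>

lemma dirichlet_nonpos:
  fixes f :: "'a \<Rightarrow> real"
  assumes u: "u \<in> V" "f u = 0" and x: "x \<in> V"
    and harm: "\<And>x. x \<in> V \<Longrightarrow> x \<noteq> u \<Longrightarrow> (\<Sum>y\<in>neighbours E x. f x - f y) = 0"
  shows "f x \<le> 0"
proof (rule ccontr)
  assume "\<not> f x \<le> 0"
  have fin: "finite (f ` V)" and ne: "f ` V \<noteq> {}" using finite_V x by auto
  define m where "m = Max (f ` V)"
  have max: "f y \<le> m" if "y \<in> V" for y unfolding m_def using fin that by auto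
  then have m: "m > 0" using \<open>\<not> f x \<le> 0\<close> x by force
  obtain x0 where x0: "x0 \<in> V" "f x0 = m" using Max_in[OF fin ne] by (auto simp: m_def)
  have "linked E x0 u" using connected x0 u by (simp add: connected_graph_def)
  then have "u \<in> V \<and> f u = m"
  proof (induction rule: rtrancl_induct)
    case base
    then show ?case using x0 by simp
  next
    case (step y z)
    then have z: "z \<in> neighbours E y" "z \<in> V" using edgeD by (auto simp: adj_def neighbours_def)
    have "y \<noteq> u" using step.IH u m by auto
    then have "(\<Sum>w\<in>neighbours E y. f y - f w) = 0" using harm step.IH by blast
    moreover have "0 \<le> f y - f w" if "w \<in> neighbours E y" for w
      using that max[of w] step.IH by (simp add: neighbours_V)
    ultimately have "\<forall>w\<in>neighbours E y. f y - f w = 0"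
      using neighbours_finite_subset(1)[OF simple] by (simp add: sum_nonneg_eq_0_iff)
    then show ?case using z step.IH by auto
  qed
  then show False using u m by simp
qed

lemma dirichlet_unique:
  fixes f :: "'a \<Rightarrow> real"
  assumes u: "u \<in> V" "f u = 0" and x: "x \<in> V"
    and harm: "\<And>x. x \<in> V \<Longrightarrow> x \<noteq> u \<Longrightarrow> (\<Sum>y\<in>neighbours E x. f x - f y) = 0"
  shows "f x = 0"
proof (rule antisym)
  show "f x \<le> 0" using assms by (rule dirichlet_nonpos)
  have "(\<Sum>y\<in>neighbours E z. - f z - - f y) = - (\<Sum>y\<in>neighbours E z. f z - f y)" for z
    by (simp flip: sum_negf)
  then have "- f x \<le> 0"
    using u x harm by (intro dirichlet_nonpos[where f = "\<lambda>x. - f x" and u = u]) simp_all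
  then show "0 \<le> f x" by simp
qed

text \<open>The normalised separated volume \<open>g\<close> and the expected hitting times
  \<open>h\<close> solve the same Dirichlet problem. For \<open>h\<close> this needs finiteness,
  which \<open>g\<close> itself provides as an upper bound.\<close>

lemma expected_hitting_time_eq:
  assumes \<Gamma>: "\<Gamma> \<noteq> {}" and V: "i \<in> V" "j \<in> V"
  shows "enn2real (expected_hitting_time V E i j) = sep_vol i j / card \<Gamma>"
proof -
  define g where "g x = sep_vol x j / card \<Gamma>" for x
  have G: "card \<Gamma> > 0" using \<Gamma> finite_\<Gamma> by (simp add: card_gt_0_iff)
  have deg: "deg x > 0" if "x \<in> V" "x \<noteq> j" for x
    using no_isolated[OF that(1) V(2) that(2)] neighbours_finite_subset(1)[OF simple]
    by (simp add: vertex_degree_def card_gt_0_iff)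
  \<comment> \<open>The Laplacian form suits the uniqueness lemma; the averaging form has only
    nonnegative terms and so transfers to \<open>ennreal\<close>.\<close>
  have solves_iff: "(\<Sum>y\<in>neighbours E x. f x - f y) = deg x \<longleftrightarrow>
      f x = 1 + (\<Sum>y\<in>neighbours E x. 1 / deg x * f y)"
    if "x \<in> V" "x \<noteq> j" for x and f :: "'a \<Rightarrow> real"
  proof -
    have "(\<Sum>y\<in>neighbours E x. f x - f y) = deg x * (f x - (\<Sum>y\<in>neighbours E x. 1 / deg x * f y))"
      using deg[OF that]
      by (simp add: sum_subtractf vertex_degree_def right_diff_distrib flip: sum_divide_distrib)
    then have "(\<Sum>y\<in>neighbours E x. f x - f y) = deg x \<longleftrightarrow>
        f x - (\<Sum>y\<in>neighbours E x. 1 / deg x * f y) = 1"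
      using deg[OF that] by simp
    then show ?thesis by linarith
  qed
  have g0: "g x \<ge> 0" "g j = 0" for x by (auto simp: g_def sep_vol_nonneg)
  have g_lap: "(\<Sum>y\<in>neighbours E x. g x - g y) = deg x" if "x \<in> V" "x \<noteq> j" for x
  proof -
    have "(\<Sum>y\<in>neighbours E x. g x - g y) = (\<Sum>y\<in>neighbours E x. sep_vol x j - sep_vol y j) / card \<Gamma>"
      by (simp add: g_def sum_divide_distrib diff_divide_distrib)
    then show ?thesis using sep_vol_laplacian[OF that(1) V(2) that(2)] G by simp
  qed
  let ?K = "\<lambda>x c. \<integral>\<^sup>+ s. min (hitting_time x j s) c \<partial>walk_space V E"
  let ?H = "\<lambda>x. expected_hitting_time V E x j"
  have sum_ennreal_avg: "1 + (\<Sum>y\<in>neighbours E x. ennreal (1 / deg x) * ennreal (f y)) =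
      ennreal (1 + (\<Sum>y\<in>neighbours E x. 1 / deg x * f y))"
    if "\<And>y. 0 \<le> f y" for f x
    using that by (simp add: ennreal_mult' [symmetric] sum_nonneg del: times_divide_eq_left)
  \<comment> \<open>Each step applies the same monotone averaging operator to both sides, and
    \<open>g\<close> is its fixed point.\<close>
  have K_le: "?K x (of_nat n) \<le> ennreal (g x)" if "x \<in> V" for n x
    using that
  proof (induction n arbitrary: x)
    case (Suc n)
    show ?case
    proof (cases "x = j")
      case False
      have "?K x (of_nat (Suc n)) = 1 + (\<Sum>y\<in>neighbours E x. ennreal (1 / deg x) * ?K y (of_nat n))"
        using truncated_hitting_time_step[OF Suc.prems V(2) False] by simp
      also have "\<dots> \<le> 1 + (\<Sum>y\<in>neighbours E x. ennreal (1 / deg x) * ennreal (g y))"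
        by (intro add_left_mono sum_mono mult_left_mono Suc.IH) (auto simp: neighbours_V)
      also have "\<dots> = ennreal (1 + (\<Sum>y\<in>neighbours E x. 1 / deg x * g y))"
        by (rule sum_ennreal_avg) (rule g0)
      also have "\<dots> = ennreal (g x)"
        using g_lap[OF Suc.prems False] solves_iff[OF Suc.prems False] by simp
      finally show ?thesis .
    qed simp
  qed simp
  have H_SUP: "?H x = (SUP n. ?K x (of_nat n))" if "x \<in> V" for x
  proof -
    have "(SUP n. min t (of_nat n)) = t" for t :: ennreal
      by (simp add: ennreal_SUP_of_nat_eq_top flip: inf_min inf_SUP)
    then have "?H x = (\<integral>\<^sup>+ s. (SUP n. min (hitting_time x j s) (of_nat n)) \<partial>walk_space V E)"
      by (simp add: expected_hitting_time_def)
    also have "\<dots> = (SUP n. ?K x (of_nat n))"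
      using measurable_hitting_time[OF that, of j]
      by (intro nn_integral_monotone_convergence_SUP)
         (auto simp: incseq_def le_fun_def intro: min.coboundedI2)
    finally show ?thesis .
  qed
  have H_le: "?H x \<le> ennreal (g x)" if "x \<in> V" for x
    unfolding H_SUP[OF that] by (intro SUP_least K_le that)
  define h where "h x = enn2real (?H x)" for x
  \<comment> \<open>The bound by \<open>g\<close> excludes infinite expectations, so the conversion
    to real values is faithful.\<close>
  have H: "?H x = ennreal (h x)" if "x \<in> V" for x
    using le_less_trans[OF H_le[OF that] ennreal_less_top] by (simp add: h_def)
  have h0: "h x \<ge> 0" for x by (simp add: h_def)
  have hj: "h j = 0" by (simp add: h_def expected_hitting_time_def)
  have h_lap: "(\<Sum>y\<in>neighbours E x. h x - h y) = deg x" if x: "x \<in> V" "x \<noteq> j" for x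
  proof -
    have "?H x = 1 + (\<Sum>y\<in>neighbours E x. ennreal (1 / deg x) * ?H y)"
      using truncated_hitting_time_step[OF x(1) V(2) x(2), of top]
      by (simp add: expected_hitting_time_def)
    also have "\<dots> = 1 + (\<Sum>y\<in>neighbours E x. ennreal (1 / deg x) * ennreal (h y))"
      using H by (simp add: neighbours_V)
    also have "\<dots> = ennreal (1 + (\<Sum>y\<in>neighbours E x. 1 / deg x * h y))"
      by (rule sum_ennreal_avg) (rule h0)
    finally have "ennreal (h x) = ennreal (1 + (\<Sum>y\<in>neighbours E x. 1 / deg x * h y))"
      using H[OF x(1)] by simp
    then have "h x = 1 + (\<Sum>y\<in>neighbours E x. 1 / deg x * h y)"
      using h0 by (subst (asm) ennreal_inj) (auto intro!: add_nonneg_nonneg sum_nonneg)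
    then show ?thesis by (rule solves_iff[OF x, THEN iffD2])
  qed
  have "g i - h i = 0"
  proof (rule dirichlet_unique[OF V(2) _ V(1)])
    fix x assume x: "x \<in> V" "x \<noteq> j"
    have "(\<Sum>y\<in>neighbours E x. (g x - h x) - (g y - h y)) =
        (\<Sum>y\<in>neighbours E x. g x - g y) - (\<Sum>y\<in>neighbours E x. h x - h y)"
      unfolding sum_subtractf[symmetric] by (simp add: algebra_simps)
    then show "(\<Sum>y\<in>neighbours E x. (g x - h x) - (g y - h y)) = 0"
      using g_lap[OF x] h_lap[OF x] by simp
  qed (simp add: g0 hj)
  then show ?thesis by (simp add: g_def h_def)
qed

text \<open>The sum over targets is the same for every start by
  \<open>weighted_sep_vol_const\<close>. If \<open>E\<close> is empty, both sides are zero by the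
  convention for division by zero.\<close>

lemma kemeny_eq:
  assumes \<Gamma>: "\<Gamma> \<noteq> {}" and r: "r \<in> V"
  shows "kemeny V E = (\<Sum>u\<in>V. deg u * sep_vol r u) / (2 * card E * card \<Gamma>)"
proof -
  have K: "(\<Sum>j\<in>V. deg j / (2 * real (card E)) * enn2real (expected_hitting_time V E i j)) =
      (\<Sum>u\<in>V. deg u * sep_vol r u) / (2 * card E * card \<Gamma>)" if i: "i \<in> V" for i
  proof -
    have "(\<Sum>j\<in>V. deg j / (2 * real (card E)) * enn2real (expected_hitting_time V E i j)) =
        (\<Sum>j\<in>V. deg j * sep_vol i j) / (2 * card E * card \<Gamma>)"
      by (simp add: expected_hitting_time_eq[OF \<Gamma> i] sum_divide_distrib)
    then show ?thesis using weighted_sep_vol_const[OF i r] by simp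
  qed
  show ?thesis
    \<comment> \<open>The vertex \<open>r\<close> shows that the condition over all starts is not
      vacuous, so only one value satisfies it.\<close>
    unfolding kemeny_def by (rule the_equality) (use K r in auto)
qed

end

section \<open>The estimator\<close>

theorem mainTheorem3:
  fixes V :: "'a set" and E :: "'a set set" and r :: 'a and P :: "'a \<Rightarrow> 'a list"
    and M :: "'b measure" and \<tau> :: "nat \<Rightarrow> 'b \<Rightarrow> 'a set set" and \<omega> :: nat
  assumes "simple_graph V E" and "connected_graph V E"
    and "r \<in> V"
    and "\<And>u. u \<in> V - {r} \<Longrightarrow> is_simple_path E u (P u) r"
    and "prob_space M"
    and "\<omega> \<ge> 1"
    and "\<And>i. i \<in> {1..\<omega>} \<Longrightarrow> \<tau> i \<in> measurable M (count_space (spanning_trees V E))"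
    and "\<And>i. i \<in> {1..\<omega>} \<Longrightarrow>
      distr M (count_space (spanning_trees V E)) (\<tau> i) = uniform_count_measure (spanning_trees V E)"
  shows "integrable M (\<lambda>x. kemeny_estimator V E r P \<omega> (\<lambda>i. \<tau> i x)) \<and>
    prob_space.expectation M (\<lambda>x. kemeny_estimator V E r P \<omega> (\<lambda>i. \<tau> i x)) = kemeny V E"
proof -
  interpret fin_connected_graph V E using assms(1,2) by unfold_locales
  interpret M: prob_space M by fact
  note meas = assms(7) and dist = assms(8)
  \<comment> \<open>A probability space is nonempty, so some value of the random tree
    \<open>\<tau> 1\<close> exhibits a spanning tree.\<close>
  have \<Gamma>: "\<Gamma> \<noteq> {}"
    using measurable_space[OF meas[of 1]] M.not_empty \<open>\<omega> \<ge> 1\<close> by fastforce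
  let ?f = "tree_stat V E r P"
  have int: "integrable M (\<lambda>x. ?f (\<tau> i x))" if i: "i \<in> {1..\<omega>}" for i
  proof -
    have "integrable (uniform_count_measure \<Gamma>) ?f"
      unfolding uniform_count_measure_def by (rule integrable_point_measure_finite) (rule finite_\<Gamma>)
    then show ?thesis
      unfolding dist[OF i, symmetric] by (subst (asm) integrable_distr_eq[OF meas[OF i]]) simp_all
  qed
  have exp: "M.expectation (\<lambda>x. ?f (\<tau> i x)) = (\<Sum>\<tau>\<in>\<Gamma>. ?f \<tau>) / card \<Gamma>" if i: "i \<in> {1..\<omega>}" for i
  proof -
    have "M.expectation (\<lambda>x. ?f (\<tau> i x)) = integral\<^sup>L (uniform_count_measure \<Gamma>) ?f"
      unfolding dist[OF i, symmetric] by (rule integral_distr[OF meas[OF i], symmetric]) simp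
    then show ?thesis by (simp add: integral_uniform_count_measure finite_\<Gamma>)
  qed
  \<comment> \<open>Linearity of expectation: only the individual laws of the sampled trees enter,
    and each is uniform.\<close>
  have "M.expectation (\<lambda>x. kemeny_estimator V E r P \<omega> (\<lambda>i. \<tau> i x)) =
      1 / (2 * real (card E) * real \<omega>) * (\<Sum>i=1..\<omega>. M.expectation (\<lambda>x. ?f (\<tau> i x)))"
    unfolding kemeny_estimator_def using int by (subst integral_mult_right_zero) (simp add: integral_sum)
  also have "\<dots> = (\<Sum>\<tau>\<in>\<Gamma>. ?f \<tau>) / (2 * card E * card \<Gamma>)"
    using exp \<open>\<omega> \<ge> 1\<close> by (simp add: field_simps)
  also have "\<dots> = kemeny V E"
    using sum_tree_stat[OF assms(3,4)] kemeny_eq[OF \<Gamma> assms(3)] by simp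
  finally show ?thesis
    using int by (auto simp: kemeny_estimator_def intro!: integrable_mult_right Bochner_Integration.integrable_sum)
qed

end
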